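(* Let $\mathbf{x}=(x,x')\in\mathbb{R}^\eta\times\mathbb{R}$, let $B=\{(t,0):t\in\mathbb{R}^\eta\}$ and $A=\operatorname{gra}f$, where $f:\mathbb{R}^\eta\to\mathbb{R}$ is proper and has a closed graph. Suppose further that $f$ is Lipschitz continuous locally at $y$, where $(y,f(y)):=P_A\mathbf{x}$. Then the following hold. (i) If $\mathbf{x},R_A\mathbf{x},R_BR_A\mathbf{x}$ are not colinear, then $$C_T\mathbf{x}=\left(y-\frac{f(y)}{\|y^*\|^2}\,y^*,\ 0\right),$$ where $y^*\in\partial^0f(y)$ satisfies $x=y+(f(y)-x')\,y^*$. (ii) Otherwise, $C_T\mathbf{x}=(y,\ x'-f(y))$.
   Context: $A,B$ are closed subsets of the Euclidean space $\mathbb{R}^{\eta+1}$ with $A\cap B\ne\emptyset$; $\operatorname{gra}f=\{(y,f(y)):y\in\operatorname{dom}f\}$. For closed nonempty $S$, $P_S$ is a fixed selector ($P_S\mathbf{x}\in\mathbb{P}_S\mathbf{x}$) of the set-valued projection $\mathbb{P}_S\mathbf{x}=\{\mathbf{z}\in S:\|\mathbf{x}-\mathbf{z}\|=\inf_{\mathbf{v}\in S}\|\mathbf{x}-\mathbf{v}\|\}$; $R_S=2P_S-\mathrm{Id}$; $T_{A,B}=\frac12R_BR_A+\frac12\mathrm{Id}$. The circumcenter $C(\mathbf{u},\mathbf{v},\mathbf{w})$ is the point of the affine hull of $\{\mathbf{u},\mathbf{v},\mathbf{w}\}$ equidistant from $\mathbf{u},\mathbf{v},\mathbf{w}$, and $\mathrm{CRM}(\mathbf{x})=C(\mathbf{x},R_A\mathbf{x},R_BR_A\mathbf{x})$.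 Three points are colinear if they lie on a common line (in particular if two of them coincide). $C_T\mathbf{x}=T_{A,B}\mathbf{x}$ if $\mathbf{x},R_A\mathbf{x},R_BR_A\mathbf{x}$ are colinear, and $C_T\mathbf{x}=\mathrm{CRM}(\mathbf{x})$ otherwise. The limiting subdifferential of $f$ at $x$ is $\partial f(x)=\{x^*\in\mathbb{R}^\eta:(x^*,-1)\in N_{\operatorname{epi}f}(x,f(x))\}$, where $N$ is the limiting (Mordukhovich) normal cone and $\operatorname{epi}f$ the epigraph; the symmetric subdifferential is $\partial^0f(x)=\partial f(x)\cup(-\partial(-f)(x))$. *)

theory Defs
  imports "HOL-Analysis.Analysis"
begin

section \<open>Extended-real-valued functions\<close>

definition effdom :: "('a \<Rightarrow> ereal) \<Rightarrow> 'a set" where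
  "effdom f = {u. f u < \<infinity>}"

definition proper :: "('a \<Rightarrow> ereal) \<Rightarrow> bool" where
  "proper f \<longleftrightarrow> effdom f \<noteq> {} \<and> (\<forall>u. f u > -\<infinity>)"

text \<open>Only meant for proper functions, for which real_of_ereal does not truncate on effdom.\<close>

definition gra :: "('a \<Rightarrow> ereal) \<Rightarrow> ('a \<times> real) set" where
  "gra f = {(u, real_of_ereal (f u)) |u. u \<in> effdom f}"

definition epi :: "('a \<Rightarrow> ereal) \<Rightarrow> ('a \<times> real) set" where
  "epi f = {(u, r). f u \<le> ereal r}"

text \<open>As usual in variational analysis, Lipschitz continuity locally at a point includes that
  the function is finite on a whole neighbourhood of that point.\<close>

definition lipschitz_locally_at :: "('a::metric_space \<Rightarrow> ereal) \<Rightarrow> 'a \<Rightarrow> bool" where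
  "lipschitz_locally_at f u \<longleftrightarrow>
     (\<exists>\<epsilon>>0. (\<forall>v\<in>ball u \<epsilon>. \<bar>f v\<bar> \<noteq> \<infinity>) \<and>
             (\<exists>L. L-lipschitz_on (ball u \<epsilon>) (\<lambda>v. real_of_ereal (f v))))"

section \<open>Normal cones and subdifferentials\<close>

text \<open>The regular (Frechet) normal cone: the upper limit of
  \<open>inner v (u - z) / norm (u - z)\<close>, as \<open>u\<close> tends to \<open>z\<close> in \<open>S\<close>, is at most 0.\<close>

definition regular_normal_cone :: "'a::real_inner set \<Rightarrow> 'a \<Rightarrow> 'a set" where
  "regular_normal_cone S z = {v. z \<in> S \<and>
     (\<forall>\<epsilon>>0. \<exists>\<delta>>0. \<forall>u\<in>S. dist u z < \<delta> \<longrightarrow> inner v (u - z) \<le> \<epsilon> * norm (u - z))}"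

definition limiting_normal_cone :: "'a::real_inner set \<Rightarrow> 'a \<Rightarrow> 'a set" where
  "limiting_normal_cone S z = {v. z \<in> S \<and>
     (\<exists>zs vs. (\<forall>k::nat. zs k \<in> S \<and> vs k \<in> regular_normal_cone S (zs k)) \<and>
              zs \<longlonglongrightarrow> z \<and> vs \<longlonglongrightarrow> v)}"

definition limiting_subdiff :: "('a::real_inner \<Rightarrow> ereal) \<Rightarrow> 'a \<Rightarrow> 'a set" where
  "limiting_subdiff f u = {v. \<bar>f u\<bar> \<noteq> \<infinity> \<and>
     (v, -1) \<in> limiting_normal_cone (epi f) (u, real_of_ereal (f u))}"

definition symmetric_subdiff :: "('a::real_inner \<Rightarrow> ereal) \<Rightarrow> 'a \<Rightarrow> 'a set" where
  "symmetric_subdiff f u = limiting_subdiff f u \<union> uminus ` limiting_subdiff (\<lambda>w. - f w) u"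

section \<open>Projections, reflections and circumcentering\<close>

definition proj_set :: "'a::real_normed_vector set \<Rightarrow> 'a \<Rightarrow> 'a set" where
  "proj_set S p = {z \<in> S. norm (p - z) = (INF v\<in>S. norm (p - v))}"

definition proj_selector :: "'a::real_normed_vector set \<Rightarrow> ('a \<Rightarrow> 'a) \<Rightarrow> bool" where
  "proj_selector S P \<longleftrightarrow> (\<forall>p. P p \<in> proj_set S p)"

text \<open>The operators below depend on the sets only through the selected projections, which are
  their arguments.\<close>

definition reflector :: "('a::real_normed_vector \<Rightarrow> 'a) \<Rightarrow> 'a \<Rightarrow> 'a" where
  "reflector P p = 2 *\<^sub>R P p - p"

definition DR :: "('a::real_normed_vector \<Rightarrow> 'a) \<Rightarrow> ('a \<Rightarrow> 'a) \<Rightarrow> 'a \<Rightarrow> 'a" where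
  "DR PA PB p = (1/2) *\<^sub>R reflector PB (reflector PA p) + (1/2) *\<^sub>R p"

definition circumcenter :: "'a::real_normed_vector \<Rightarrow> 'a \<Rightarrow> 'a \<Rightarrow> 'a" where
  "circumcenter u v w =
     (THE c. c \<in> affine hull {u, v, w} \<and> dist c u = dist c v \<and> dist c v = dist c w)"

definition CRM :: "('a::real_normed_vector \<Rightarrow> 'a) \<Rightarrow> ('a \<Rightarrow> 'a) \<Rightarrow> 'a \<Rightarrow> 'a" where
  "CRM PA PB p = circumcenter p (reflector PA p) (reflector PB (reflector PA p))"

definition CT :: "('a::real_normed_vector \<Rightarrow> 'a) \<Rightarrow> ('a \<Rightarrow> 'a) \<Rightarrow> 'a \<Rightarrow> 'a" where
  "CT PA PB p =
     (if collinear {p, reflector PA p, reflector PB (reflector PA p)}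
      then DR PA PB p else CRM PA PB p)"

end

theory Submission
  imports Defs
begin

text \<open>
  Write \<open>p = (x, x')\<close>. Projecting onto \<open>B\<close> drops the last coordinate, so reflecting in \<open>B\<close>
  flips its sign; the three points are \<open>(x, x')\<close>, \<open>(2y - x, 2 f(y) - x')\<close> and
  \<open>(2y - x, x' - 2 f(y))\<close>. The midpoint of the first and the third is \<open>(y, x' - f(y))\<close>, which is
  the colinear case.

  In the other case \<open>x \<noteq> y\<close>, since the three points would otherwise lie on a vertical line.
  As \<open>(y, f(y))\<close> is a point of the graph nearest to \<open>p\<close>, the vector \<open>(x - y, x' - f(y))\<close> is a
  proximal normal to the graph. Over a Lipschitz point this vector cannot be horizontal
  (\<open>lipschitz_nearest_same_height\<close>), so \<open>x' \<noteq> f(y)\<close>, and the equation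
  \<open>x = y + (f(y) - x') y*\<close> has exactly one solution \<open>y*\<close>, which is nonzero. If \<open>p\<close> lies below
  \<open>(y, f(y))\<close>, then \<open>(y*, -1)\<close> is a positive multiple of the proximal normal and is normal to
  the epigraph as well (\<open>limiting_subdiff_nearest_from_below\<close>); if \<open>p\<close> lies above, the same
  argument applies to \<open>-f\<close> after reflecting the picture in \<open>B\<close>. Hence \<open>y*\<close> lies in the
  symmetric subdifferential.

  With \<open>d = f(y) - x'\<close> the triangle has vertices \<open>(y + d y*, x')\<close> and
  \<open>(y - d y*, \<plusminus>(x' - 2 f(y)))\<close>. A circumcenter is unique (\<open>circumcenter_eqI\<close>), so it remains to
  compute that the claimed point is equidistant from the vertices and lies in their affine hull
  (\<open>circumcenter_reflected_triangle\<close>).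
\<close>

section \<open>Nearest points and projections\<close>

lemma proj_set_norm_le:
  assumes "z \<in> proj_set S p" "v \<in> S"
  shows "norm (p - z) \<le> norm (p - v)"
proof -
  have "(INF v\<in>S. norm (p - v)) \<le> norm (p - v)"
    by (rule cINF_lower) (use assms in \<open>auto intro!: bdd_belowI2[where m = 0]\<close>)
  then show ?thesis using assms by (simp add: proj_set_def)
qed

lemma proj_set_horizontal:
  fixes u :: "'a::real_normed_vector"
  assumes "z \<in> proj_set {(t, 0::real) |t. True} (u, r)"
  shows "z = (u, 0)"
proof -
  obtain t where z: "z = (t, 0)" using assms by (auto simp: proj_set_def)
  have "norm ((u, r) - (t, 0::real)) \<le> norm ((u, r) - (u, 0))"
    using proj_set_norm_le[OF assms, of "(u, 0)"] z by auto
  then have "(norm (u - t))\<^sup>2 + r\<^sup>2 \<le> r\<^sup>2"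
    by (simp add: norm_Pair flip: real_sqrt_abs)
  then show ?thesis using z by simp
qed

text \<open>The proximal normal inequality: expand the square of \<open>norm ((p - q) - (z - q))\<close>.\<close>

lemma nearest_imp_inner_le:
  fixes p q z :: "'a::real_inner"
  assumes "norm (p - q) \<le> norm (p - z)"
  shows "2 * inner (p - q) (z - q) \<le> (norm (z - q))\<^sup>2"
proof -
  have "(norm (p - q))\<^sup>2 \<le> (norm ((p - q) - (z - q)))\<^sup>2"
    using assms by (simp add: power_mono)
  also have "\<dots> = (norm (p - q))\<^sup>2 + (norm (z - q))\<^sup>2 - 2 * inner (p - q) (z - q)"
    by (simp only: power2_norm_eq_inner inner_diff_left[of "p - q" "z - q"]
          inner_diff_right[of _ "p - q" "z - q"] inner_commute[of "z - q" "p - q"])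
  finally show ?thesis by simp
qed

section \<open>Normals to the graph at a Lipschitz point\<close>

lemma lipschitz_locally_atE:
  assumes "lipschitz_locally_at f y" "f y = ereal fy"
  obtains \<epsilon> L where "\<epsilon> > 0" "L \<ge> 0"
    "\<And>v. norm (v - y) < \<epsilon> \<Longrightarrow> \<exists>r. f v = ereal r \<and> \<bar>r - fy\<bar> \<le> L * norm (v - y)"
proof -
  from assms(1) obtain \<epsilon> L where e: "\<epsilon> > 0" and fin: "\<forall>v\<in>ball y \<epsilon>. \<bar>f v\<bar> \<noteq> \<infinity>"
    and lip: "L-lipschitz_on (ball y \<epsilon>) (\<lambda>v. real_of_ereal (f v))"
    unfolding lipschitz_locally_at_def by blast
  show thesis
  proof
    show "\<epsilon> > 0" by fact
    show "L \<ge> 0" using lip by (rule lipschitz_on_nonneg)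
    fix v assume "norm (v - y) < \<epsilon>"
    then have v: "v \<in> ball y \<epsilon>" by (simp add: dist_norm norm_minus_commute)
    have "f v = ereal (real_of_ereal (f v))" using fin v by (auto simp: ereal_real)
    moreover have "\<bar>real_of_ereal (f v) - fy\<bar> \<le> L * norm (v - y)"
      using lipschitz_onD[OF lip v, of y] e assms(2) by (simp add: dist_norm)
    ultimately show "\<exists>r. f v = ereal r \<and> \<bar>r - fy\<bar> \<le> L * norm (v - y)" by blast
  qed
qed

text \<open>A horizontal proximal normal vanishes: moving from \<open>y\<close> towards \<open>x\<close> by a small fraction
  \<open>t\<close> decreases the squared distance to \<open>(x, f y)\<close> to first order in \<open>t\<close>, while the Lipschitz
  bound lets the change of height cost only order \<open>t\<^sup>2\<close>.\<close>

lemma lipschitz_nearest_same_height: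
  fixes f :: "'a::real_inner \<Rightarrow> ereal"
  assumes lip: "lipschitz_locally_at f y" and fy: "f y = ereal fy"
    and near: "\<And>v r. f v = ereal r \<Longrightarrow> norm ((x, fy) - (y, fy)) \<le> norm ((x, fy) - (v, r))"
  shows "x = y"
proof (rule ccontr)
  assume "x \<noteq> y"
  define d where "d = norm (x - y)"
  have d: "d > 0" using \<open>x \<noteq> y\<close> by (simp add: d_def)
  obtain \<epsilon> L where e: "\<epsilon> > 0" and L: "L \<ge> 0"
    and lipD: "\<And>v. norm (v - y) < \<epsilon> \<Longrightarrow> \<exists>r. f v = ereal r \<and> \<bar>r - fy\<bar> \<le> L * norm (v - y)"
    using lipschitz_locally_atE[OF lip fy] by metis
  \<comment> \<open>The first bound keeps the moved point in the Lipschitz ball, the second makes the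
    second-order term at most half of the first-order gain.\<close>
  define t where "t = min (\<epsilon> / (2 * d)) (1 / (1 + L\<^sup>2))"
  have L1: "1 + L\<^sup>2 > 0" by (simp add: add_pos_nonneg)
  have t: "t > 0" using e d L1 by (simp add: t_def)
  have "t * d \<le> \<epsilon> / (2 * d) * d" by (rule mult_right_mono) (use d in \<open>auto simp: t_def\<close>)
  then have td: "t * d < \<epsilon>" using e d by simp
  have tL: "(1 + L\<^sup>2) * t \<le> 1"
  proof -
    have "(1 + L\<^sup>2) * t \<le> (1 + L\<^sup>2) * (1 / (1 + L\<^sup>2))"
      by (rule mult_left_mono) (use L1 in \<open>auto simp: t_def\<close>)
    then show ?thesis using L1 by simp
  qed
  define v where "v = y + t *\<^sub>R (x - y)"
  have vy: "norm (v - y) = t * d" using t by (simp add: v_def d_def)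
  obtain r where r: "f v = ereal r" "\<bar>r - fy\<bar> \<le> L * (t * d)"
    using lipD[of v] vy td by auto
  have "2 * inner ((x, fy) - (y, fy)) ((v, r) - (y, fy)) \<le> (norm ((v, r) - (y, fy)))\<^sup>2"
    by (rule nearest_imp_inner_le) (rule near[OF r(1)])
  also have "(norm ((v, r) - (y, fy)))\<^sup>2 = (t * d)\<^sup>2 + (r - fy)\<^sup>2"
    by (simp add: norm_Pair vy)
  also have "\<dots> \<le> (t * d)\<^sup>2 + (L * (t * d))\<^sup>2"
    using r(2) power_mono[OF r(2), of 2] by simp
  also have "\<dots> = ((1 + L\<^sup>2) * t) * (t * d\<^sup>2)" by (simp add: algebra_simps power2_eq_square)
  also have "\<dots> \<le> 1 * (t * d\<^sup>2)" by (rule mult_right_mono[OF tL]) (use t in simp)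
  finally have "2 * (t * d\<^sup>2) \<le> t * d\<^sup>2"
    by (simp add: v_def d_def power2_norm_eq_inner)
  moreover have "t * d\<^sup>2 > 0" using t d by simp
  ultimately show False by simp
qed

lemma regular_imp_limiting_normal:
  "v \<in> regular_normal_cone S z \<Longrightarrow> v \<in> limiting_normal_cone S z"
  unfolding limiting_normal_cone_def
  by (rule CollectI, rule conjI, simp add: regular_normal_cone_def,
      rule exI[of _ "\<lambda>_. z"], rule exI[of _ "\<lambda>_. v"]) (simp add: regular_normal_cone_def)

text \<open>Passing from the graph to the epigraph is possible since the normal points downwards:
  raising a point \<open>(u, f u)\<close> to \<open>(u, s)\<close> lowers its inner product with \<open>(y*, -1)\<close>. On the
  right-hand side the Lipschitz bound serves to estimate the distance of \<open>(u, f u)\<close> from the base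
  point by \<open>norm (u - y)\<close>, hence by the distance of \<open>(u, s)\<close>; this gives a quadratic upper
  bound, which is smaller than any linear one near the base point.\<close>

lemma limiting_subdiff_nearest_from_below:
  fixes f :: "'a::real_inner \<Rightarrow> ereal"
  assumes lip: "lipschitz_locally_at f y" and fy: "f y = ereal fy" and below: "x' < fy"
    and near: "\<And>v r. f v = ereal r \<Longrightarrow> norm ((x, x') - (y, fy)) \<le> norm ((x, x') - (v, r))"
  shows "(1 / (fy - x')) *\<^sub>R (x - y) \<in> limiting_subdiff f y"
proof -
  define h where "h = fy - x'"
  define n where "n = ((1 / h) *\<^sub>R (x - y), -1::real)"
  have h: "h > 0" using below by (simp add: h_def)
  obtain \<epsilon>\<^sub>0 L where e0: "\<epsilon>\<^sub>0 > 0" and L: "L \<ge> 0"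
    and lipD: "\<And>v. norm (v - y) < \<epsilon>\<^sub>0 \<Longrightarrow> \<exists>r. f v = ereal r \<and> \<bar>r - fy\<bar> \<le> L * norm (v - y)"
    using lipschitz_locally_atE[OF lip fy] by metis
  define K where "K = (1 + L\<^sup>2) / (2 * h)"
  have L1: "1 + L\<^sup>2 > 0" by (simp add: add_pos_nonneg)
  have K: "K > 0" using L1 h by (simp add: K_def)
  have quad: "inner n ((u, s) - (y, fy)) \<le> K * (norm ((u, s) - (y, fy)))\<^sup>2"
    if epi: "f u \<le> ereal s" and u: "norm (u - y) < \<epsilon>\<^sub>0" for u s
  proof -
    obtain r where r: "f u = ereal r" "\<bar>r - fy\<bar> \<le> L * norm (u - y)" using lipD[OF u] by auto
    have rs: "r \<le> s" using epi r by simp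
    have hn: "(x, x') - (y, fy) = h *\<^sub>R n" using h by (simp add: n_def h_def)
    have "inner n ((u, s) - (y, fy)) \<le> inner n ((u, r) - (y, fy))" using rs by (simp add: n_def)
    moreover have "2 * h * inner n ((u, r) - (y, fy)) \<le> (norm ((u, r) - (y, fy)))\<^sup>2"
      using nearest_imp_inner_le[OF near[OF r(1)]] unfolding hn by simp
    ultimately have "inner n ((u, s) - (y, fy)) \<le> (norm ((u, r) - (y, fy)))\<^sup>2 / (2 * h)"
      using h by (simp add: pos_le_divide_eq mult.commute) (smt (verit) mult_left_mono)
    also have "(norm ((u, r) - (y, fy)))\<^sup>2 = (norm (u - y))\<^sup>2 + (r - fy)\<^sup>2"
      by (simp add: norm_Pair)
    also have "\<dots> \<le> (norm (u - y))\<^sup>2 + (L * norm (u - y))\<^sup>2"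
      using power_mono[OF r(2), of 2] by simp
    also have "\<dots> = (1 + L\<^sup>2) * (norm (u - y))\<^sup>2" by (simp add: algebra_simps)
    also have "\<dots> \<le> (1 + L\<^sup>2) * (norm ((u, s) - (y, fy)))\<^sup>2"
      using L1 by (intro mult_left_mono) (auto simp: norm_Pair)
    finally show ?thesis using h by (simp add: K_def divide_right_mono)
  qed
  have "n \<in> regular_normal_cone (epi f) (y, fy)"
    unfolding regular_normal_cone_def
  proof (intro CollectI conjI allI impI)
    show "(y, fy) \<in> epi f" using fy by (simp add: epi_def)
    fix \<epsilon> :: real assume e: "\<epsilon> > 0"
    show "\<exists>\<delta>>0. \<forall>w\<in>epi f. dist w (y, fy) < \<delta> \<longrightarrow>
        inner n (w - (y, fy)) \<le> \<epsilon> * norm (w - (y, fy))"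
    proof (intro exI[of _ "min \<epsilon>\<^sub>0 (\<epsilon> / K)"] conjI ballI impI)
      show "min \<epsilon>\<^sub>0 (\<epsilon> / K) > 0" using e e0 K by simp
      fix w assume w: "w \<in> epi f" "dist w (y, fy) < min \<epsilon>\<^sub>0 (\<epsilon> / K)"
      obtain u s where us: "w = (u, s)" by (cases w)
      define D where "D = norm (w - (y, fy))"
      have D: "D < \<epsilon>\<^sub>0" "D < \<epsilon> / K" using w by (auto simp: D_def dist_norm)
      have "norm (u - y) \<le> D" using norm_fst_le[of "u - y" "s - fy"] by (simp add: D_def us)
      then have "inner n (w - (y, fy)) \<le> K * D\<^sup>2"
        using quad[of u s] w D by (simp add: us epi_def D_def)
      also have "\<dots> = (K * D) * D" by (simp add: power2_eq_square)
      also have "\<dots> \<le> \<epsilon> * D"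
        using D K by (intro mult_right_mono) (auto simp: D_def pos_less_divide_eq mult.commute)
      finally show "inner n (w - (y, fy)) \<le> \<epsilon> * norm (w - (y, fy))" by (simp add: D_def)
    qed
  qed
  then show ?thesis
    using regular_imp_limiting_normal fy by (auto simp: limiting_subdiff_def n_def h_def)
qed

text \<open>When \<open>(x, x')\<close> lies above the graph point, the sign change \<open>(v, r) \<mapsto> (v, -r)\<close> turns the
  situation into the previous one for \<open>-f\<close>.\<close>

lemma symmetric_subdiff_nearest:
  fixes f :: "'a::real_inner \<Rightarrow> ereal"
  assumes lip: "lipschitz_locally_at f y" and fy: "f y = ereal fy" and ne: "x' \<noteq> fy"
    and near: "\<And>v r. f v = ereal r \<Longrightarrow> norm ((x, x') - (y, fy)) \<le> norm ((x, x') - (v, r))"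
  shows "(1 / (fy - x')) *\<^sub>R (x - y) \<in> symmetric_subdiff f y"
proof (cases "x' < fy")
  case True
  then show ?thesis
    using limiting_subdiff_nearest_from_below[OF lip fy True near]
    by (auto simp: symmetric_subdiff_def)
next
  case False
  have lip': "lipschitz_locally_at (\<lambda>w. - f w) y"
    using lip by (auto simp: lipschitz_locally_at_def)
  have "(1 / (- fy - - x')) *\<^sub>R (x - y) \<in> limiting_subdiff (\<lambda>w. - f w) y"
  proof (rule limiting_subdiff_nearest_from_below[OF lip'])
    show "- f y = ereal (- fy)" "- x' < - fy" using fy False ne by auto
    fix v r assume "- f v = ereal r"
    then have "f v = ereal (- r)" by (metis ereal_uminus_uminus uminus_ereal.simps(1))
    from near[OF this] show "norm ((x, - x') - (y, - fy)) \<le> norm ((x, - x') - (v, r))"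
      by (simp add: norm_Pair power2_eq_square algebra_simps)
  qed
  moreover have "(1 / (fy - x')) *\<^sub>R (x - y) = - ((1 / (- fy - - x')) *\<^sub>R (x - y))"
  proof -
    have "1 / (fy - x') = - (1 / (- fy - - x'))" using ne by (simp add: field_simps)
    then show ?thesis by (metis scaleR_minus_left)
  qed
  ultimately show ?thesis unfolding symmetric_subdiff_def by blast
qed

section \<open>Circumcenters\<close>

text \<open>The difference of two candidates is orthogonal to both edges at \<open>u\<close>, and it is itself a
  linear combination of these edges, so it is orthogonal to itself.\<close>

lemma circumcenter_eqI:
  fixes u v w c :: "'a::real_inner"
  assumes c: "c \<in> affine hull {u, v, w}" "dist c u = dist c v" "dist c v = dist c w"
  shows "circumcenter u v w = c"
  unfolding circumcenter_def
proof (rule the_equality)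
  fix c' assume c': "c' \<in> affine hull {u, v, w} \<and> dist c' u = dist c' v \<and> dist c' v = dist c' w"
  have orth: "inner (c' - c) (a - u) = 0" if "dist c u = dist c a" "dist c' u = dist c' a" for a
  proof -
    have sq: "2 * inner (z - u) (a - u) = inner (a - u) (a - u)" if "dist z u = dist z a" for z
    proof -
      have "inner (z - u) (z - u) = inner (z - a) (z - a)"
        using that by (simp add: dist_norm norm_eq)
      then show ?thesis by (simp add: inner_diff_left inner_diff_right inner_commute)
    qed
    have "inner (c' - c) (a - u) = inner (c' - u) (a - u) - inner (c - u) (a - u)"
      by (simp add: inner_diff_left)
    then show ?thesis using sq[OF that(1)] sq[OF that(2)] by simp
  qed
  have edges: "\<exists>\<beta> \<gamma>. z = u + \<beta> *\<^sub>R (v - u) + \<gamma> *\<^sub>R (w - u)" if "z \<in> affine hull {u, v, w}" for z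
  proof -
    obtain \<alpha> \<beta> \<gamma> where z: "z = \<alpha> *\<^sub>R u + \<beta> *\<^sub>R v + \<gamma> *\<^sub>R w" and s: "\<alpha> + \<beta> + \<gamma> = 1"
      using \<open>z \<in> affine hull {u, v, w}\<close> unfolding affine_hull_3 by blast
    have \<alpha>: "\<alpha> = 1 - \<beta> - \<gamma>" using s by simp
    have "z = u + \<beta> *\<^sub>R (v - u) + \<gamma> *\<^sub>R (w - u)" unfolding z \<alpha> by (simp add: algebra_simps)
    then show ?thesis by blast
  qed
  obtain \<beta> \<gamma> \<beta>' \<gamma>' where bc: "c = u + \<beta> *\<^sub>R (v - u) + \<gamma> *\<^sub>R (w - u)"
    and bc': "c' = u + \<beta>' *\<^sub>R (v - u) + \<gamma>' *\<^sub>R (w - u)"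
    using edges c(1) c' by metis
  have "c' - c = (\<beta>' - \<beta>) *\<^sub>R (v - u) + (\<gamma>' - \<gamma>) *\<^sub>R (w - u)"
    unfolding bc bc' by (simp add: algebra_simps)
  then have "inner (c' - c) (c' - c) = 0"
    using orth[of v] orth[of w] c c' by (simp add: inner_add_right)
  then show "c' = c" by simp
qed (use c in auto)

text \<open>With \<open>d = h - x'\<close>, equidistance amounts to the identity
  \<open>4 * d * h + x'\<^sup>2 = (2 * h - x')\<^sup>2\<close>. The assumption \<open>x' \<noteq> 2 * h\<close> separates the last
  two vertices, so that their affine hull contains a vertical line.\<close>

lemma circumcenter_reflected_triangle:
  fixes y s :: "'a::real_inner" and h x' :: real
  assumes s: "s \<noteq> 0" and ne: "x' \<noteq> h" "x' \<noteq> 2 * h"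
  shows "circumcenter (y + (h - x') *\<^sub>R s, x') (y - (h - x') *\<^sub>R s, 2 * h - x')
           (y - (h - x') *\<^sub>R s, x' - 2 * h) = (y - (h / (norm s)\<^sup>2) *\<^sub>R s, 0)"
proof (rule circumcenter_eqI)
  define d where "d = h - x'"
  define k where "k = h / (norm s)\<^sup>2"
  have d: "d \<noteq> 0" using ne by (simp add: d_def)
  have ks: "k * (norm s)\<^sup>2 = h" using s by (simp add: k_def)
  have x': "x' = h - d" by (simp add: d_def)
  \<comment> \<open>The weight of the first vertex is forced by the horizontal coordinate; the other two
    weights share the rest, their difference being chosen to make the height zero.\<close>
  define \<alpha> where "\<alpha> = (1 - k / d) / 2"
  define e where "e = \<alpha> * x' / (2 * h - x')"
  define \<beta> where "\<beta> = (1 - \<alpha> - e) / 2"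
  define \<gamma> where "\<gamma> = (1 - \<alpha> + e) / 2"
  have sum: "\<alpha> + \<beta> + \<gamma> = 1" by (simp add: \<beta>_def \<gamma>_def field_simps)
  have hor: "\<alpha> * d - \<beta> * d - \<gamma> * d = - k"
  proof -
    have "\<alpha> * d - \<beta> * d - \<gamma> * d = (2 * \<alpha> - 1) * d"
      using sum by (simp add: algebra_simps flip: distrib_left) (simp add: \<beta>_def \<gamma>_def field_simps)
    also have "\<dots> = - (k / d) * d" unfolding \<alpha>_def by (simp add: field_simps)
    also have "\<dots> = - k" using d by simp
    finally show ?thesis .
  qed
  have "\<beta> - \<gamma> = - e" by (simp add: \<beta>_def \<gamma>_def field_simps)
  moreover have "e * (2 * h - x') = \<alpha> * x'" using ne by (simp add: e_def)
  ultimately have ver: "\<alpha> * x' + \<beta> * (2 * h - x') + \<gamma> * (x' - 2 * h) = 0"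
    by (smt (verit) left_diff_distrib minus_mult_left mult_minus_right)
  have "(y - k *\<^sub>R s, 0) = \<alpha> *\<^sub>R (y + d *\<^sub>R s, x') + \<beta> *\<^sub>R (y - d *\<^sub>R s, 2 * h - x')
      + \<gamma> *\<^sub>R (y - d *\<^sub>R s, x' - 2 * h)"
  proof -
    have "\<alpha> *\<^sub>R (y + d *\<^sub>R s) + \<beta> *\<^sub>R (y - d *\<^sub>R s) + \<gamma> *\<^sub>R (y - d *\<^sub>R s)
        = (\<alpha> + \<beta> + \<gamma>) *\<^sub>R y + (\<alpha> * d - \<beta> * d - \<gamma> * d) *\<^sub>R s"
      by (simp add: algebra_simps)
    then show ?thesis using ver by (simp add: sum hor)
  qed
  then show "(y - (h / (norm s)\<^sup>2) *\<^sub>R s, 0) \<in> affine hull {(y + (h - x') *\<^sub>R s, x'),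
      (y - (h - x') *\<^sub>R s, 2 * h - x'), (y - (h - x') *\<^sub>R s, x' - 2 * h)}"
    unfolding affine_hull_3 using sum by (auto simp: k_def d_def)
  have "(norm ((- k - d) *\<^sub>R s))\<^sup>2 + x'\<^sup>2 = (norm ((d - k) *\<^sub>R s))\<^sup>2 + (2 * h - x')\<^sup>2"
  proof -
    have "(norm ((- k - d) *\<^sub>R s))\<^sup>2 - (norm ((d - k) *\<^sub>R s))\<^sup>2 = 4 * d * (k * (norm s)\<^sup>2)"
      by (simp add: power_mult_distrib) (simp add: power2_eq_square algebra_simps)
    also have "\<dots> = (2 * h - x')\<^sup>2 - x'\<^sup>2"
      unfolding ks by (simp add: x' power2_eq_square algebra_simps)
    finally show ?thesis by simp
  qed
  moreover have "(y - k *\<^sub>R s) - (y + d *\<^sub>R s) = (- k - d) *\<^sub>R s"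
    "(y - k *\<^sub>R s) - (y - d *\<^sub>R s) = (d - k) *\<^sub>R s" by (simp_all add: algebra_simps)
  ultimately show "dist (y - (h / (norm s)\<^sup>2) *\<^sub>R s, 0) (y + (h - x') *\<^sub>R s, x') =
      dist (y - (h / (norm s)\<^sup>2) *\<^sub>R s, 0) (y - (h - x') *\<^sub>R s, 2 * h - x')"
    unfolding dist_Pair_Pair dist_norm k_def[symmetric] d_def[symmetric]
    by (simp add: norm_Pair power2_commute)
  show "dist (y - (h / (norm s)\<^sup>2) *\<^sub>R s, 0) (y - (h - x') *\<^sub>R s, 2 * h - x') =
      dist (y - (h / (norm s)\<^sup>2) *\<^sub>R s, 0) (y - (h - x') *\<^sub>R s, x' - 2 * h)"
    by (simp add: dist_Pair_Pair dist_real_def abs_minus_commute)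
qed

section \<open>The circumcentered operator for a hyperplane and a graph\<close>

theorem theorem4p2:
  fixes f :: "real ^ 'n \<Rightarrow> ereal"
    and A B :: "((real ^ 'n) \<times> real) set"
    and PA PB :: "(real ^ 'n) \<times> real \<Rightarrow> (real ^ 'n) \<times> real"
    and x y :: "real ^ 'n" and x' fy :: real
  assumes "proper f"
    and "closed (gra f)"
    and "A = gra f"
    and "B = {(t, 0) |t. True}"
    and "A \<inter> B \<noteq> {}"
    and "proj_selector A PA"
    and "proj_selector B PB"
    and "PA (x, x') = (y, fy)"
    and "f y = ereal fy"
    and "lipschitz_locally_at f y"
  shows "(\<not> collinear {(x, x'), reflector PA (x, x'), reflector PB (reflector PA (x, x'))} \<longrightarrow>
            (\<exists>ys \<in> symmetric_subdiff f y. x = y + (fy - x') *\<^sub>R ys) \<and>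
            (\<forall>ys \<in> symmetric_subdiff f y. x = y + (fy - x') *\<^sub>R ys \<longrightarrow>
               ys \<noteq> 0 \<and> CT PA PB (x, x') = (y - (fy / (norm ys)\<^sup>2) *\<^sub>R ys, 0)))
       \<and> (collinear {(x, x'), reflector PA (x, x'), reflector PB (reflector PA (x, x'))} \<longrightarrow>
            CT PA PB (x, x') = (y, x' - fy))"
proof -
  let ?p = "(x, x')"
  have RA: "reflector PA ?p = (2 *\<^sub>R y - x, 2 * fy - x')"
    by (simp add: reflector_def assms(8))
  have PB: "PB (u, r) = (u, 0)" for u r
    using assms(7) proj_set_horizontal[of _ u r] unfolding assms(4) proj_selector_def by blast
  have flip_B: "reflector PB (u, r) = (u, - r)" for u r
    by (simp add: reflector_def PB scaleR_2)
  have RB: "reflector PB (reflector PA ?p) = (2 *\<^sub>R y - x, x' - 2 * fy)"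
    unfolding RA flip_B by simp
  have near: "norm (?p - (y, fy)) \<le> norm (?p - (v, r))" if "f v = ereal r" for v r
  proof (rule proj_set_norm_le)
    show "(y, fy) \<in> proj_set A ?p" using assms(6,8) by (metis proj_selector_def)
    show "(v, r) \<in> A" using that by (force simp: assms(3) gra_def effdom_def)
  qed
  have colin: "CT PA PB ?p = (y, x' - fy)"
    if "collinear {?p, reflector PA ?p, reflector PB (reflector PA ?p)}"
  proof -
    have "DR PA PB ?p = (1 / 2) *\<^sub>R ((2 *\<^sub>R y - x, x' - 2 * fy) + ?p)"
      unfolding DR_def RB by (rule scaleR_right_distrib[symmetric])
    also have "(2 *\<^sub>R y - x, x' - 2 * fy) + ?p = 2 *\<^sub>R (y, x' - fy)" by simp
    also have "(1 / 2) *\<^sub>R \<dots> = (y, x' - fy)" by simp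
    finally have "DR PA PB ?p = (y, x' - fy)" .
    then show ?thesis using that by (simp add: CT_def)
  qed
  have noncolin: "(\<exists>ys \<in> symmetric_subdiff f y. x = y + (fy - x') *\<^sub>R ys) \<and>
      (\<forall>ys \<in> symmetric_subdiff f y. x = y + (fy - x') *\<^sub>R ys \<longrightarrow>
         ys \<noteq> 0 \<and> CT PA PB ?p = (y - (fy / (norm ys)\<^sup>2) *\<^sub>R ys, 0))"
    if nc: "\<not> collinear {?p, reflector PA ?p, reflector PB (reflector PA ?p)}"
  proof (intro conjI ballI impI)
    have "x \<noteq> y"
    proof
      assume "x = y"
      then have "{?p, reflector PA ?p, reflector PB (reflector PA ?p)}
          = {(y, x'), (y, 2 * fy - x'), (y, x' - 2 * fy)}"
        unfolding RB unfolding RA by (simp add: scaleR_2)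
      moreover have "collinear {(y, x'), (y, 2 * fy - x'), (y, x' - 2 * fy)}"
        unfolding collinear_def
      proof (intro exI[of _ "(0, 1)"] ballI)
        fix a b assume "a \<in> {(y, x'), (y, 2 * fy - x'), (y, x' - 2 * fy)}"
          "b \<in> {(y, x'), (y, 2 * fy - x'), (y, x' - 2 * fy)}"
        then have "a - b = (snd a - snd b) *\<^sub>R (0, 1)"
          by (auto simp: zero_prod_def)
        then show "\<exists>c. a - b = c *\<^sub>R (0, 1)" by blast
      qed
      ultimately show False using nc by simp
    qed
    have ne: "x' \<noteq> fy"
      using lipschitz_nearest_same_height[OF assms(10,9)] near \<open>x \<noteq> y\<close> by blast
    have ne2: "x' \<noteq> 2 * fy"
    proof
      \<comment> \<open>Here the second reflection would fix its argument, leaving at most two points.\<close>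
      assume "x' = 2 * fy"
      then have "reflector PB (reflector PA ?p) = reflector PA ?p"
        unfolding RA flip_B by simp
      then show False using nc by (simp add: collinear_2)
    qed
    show "\<exists>ys \<in> symmetric_subdiff f y. x = y + (fy - x') *\<^sub>R ys"
      using symmetric_subdiff_nearest[OF assms(10,9) ne near] ne by (intro bexI) auto
    fix ys assume xs: "x = y + (fy - x') *\<^sub>R ys"
    show ys: "ys \<noteq> 0" using xs \<open>x \<noteq> y\<close> by auto
    have "2 *\<^sub>R y - x = y - (fy - x') *\<^sub>R ys" unfolding xs by (simp add: scaleR_2)
    then have "CRM PA PB ?p = (y - (fy / (norm ys)\<^sup>2) *\<^sub>R ys, 0)"
      using circumcenter_reflected_triangle[OF ys ne ne2, of y]
      unfolding CRM_def RB unfolding RA by (simp flip: xs)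
    then show "CT PA PB ?p = (y - (fy / (norm ys)\<^sup>2) *\<^sub>R ys, 0)" using nc by (simp add: CT_def)
  qed
  show ?thesis using colin noncolin by blast
qed

end
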